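(* $MC(H_4)\ge 8$, where $H_4$ is the finite Coxeter group with generators $s_1,s_2,s_3,s_4$ and relations $s_i^2=1$, $(s_1s_2)^5=(s_2s_3)^3=(s_3s_4)^3=1$, $(s_1s_3)^2=(s_1s_4)^2=(s_2s_4)^2=1$.
   Context: Let $(W,S)$ be a finite Coxeter system with length function $\ell$, and let $R=\bigcup_{w\in W,\,s\in S}\{wsw^{-1}\}$ be its set of reflections. For $w\in W$ set $N(w)=\{t\in R\mid \ell(wt)<\ell(w)\}$. A subset $Y\subset W$ is inversion complete if $\bigcup_{w\in Y}N(w)=R$; it is minimal inversion complete if it is inversion complete and no proper subset of $Y$ is inversion complete. If $(W,S)$ is of type $T$, $MC(T)$ denotes the maximal cardinality of a minimal inversion complete subset of $W$. *)

theory Defs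
  imports "HOL-Algebra.Group"
begin

section \<open>Group presentations\<close>

text \<open>
  A letter \<open>(a, True)\<close> stands for the generator \<open>a\<close>, and \<open>(a, False)\<close> for its formal inverse.
\<close>

type_synonym 'a gword = "('a \<times> bool) list"

inductive pres_eq :: "'a gword set \<Rightarrow> 'a gword \<Rightarrow> 'a gword \<Rightarrow> bool"
  for Rels :: "'a gword set"
where
  refl: "pres_eq Rels u u"
| sym: "pres_eq Rels u v \<Longrightarrow> pres_eq Rels v u"
| trans: "pres_eq Rels u v \<Longrightarrow> pres_eq Rels v w \<Longrightarrow> pres_eq Rels u w"
| cancel: "pres_eq Rels (u @ [(a, b), (a, \<not> b)] @ v) (u @ v)"
| relator: "r \<in> Rels \<Longrightarrow> pres_eq Rels (u @ r @ v) (u @ v)"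

definition pres_rel :: "'a gword set \<Rightarrow> ('a gword \<times> 'a gword) set" where
  "pres_rel Rels = {(u, v). pres_eq Rels u v}"

text \<open>All elements of the type \<open>'a\<close> are generators.\<close>

definition presented_group :: "'a gword set \<Rightarrow> 'a gword set monoid" where
  "presented_group Rels =
     \<lparr>carrier = UNIV // pres_rel Rels,
      mult = (\<lambda>A B. \<Union>u\<in>A. \<Union>v\<in>B. pres_rel Rels `` {u @ v}),
      one = pres_rel Rels `` {[]}\<rparr>"

definition pres_gen :: "'a gword set \<Rightarrow> 'a \<Rightarrow> 'a gword set" where
  "pres_gen Rels a = pres_rel Rels `` {[(a, True)]}"

lemma equiv_pres_rel: "equiv UNIV (pres_rel Rels)"
  unfolding pres_rel_def
  by (auto intro!: equivI refl_onI symI transI intro: pres_eq.refl pres_eq.sym pres_eq.trans)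

lemma pres_eq_append_context:
  "pres_eq Rels u v \<Longrightarrow> pres_eq Rels (x @ u @ y) (x @ v @ y)"
proof (induction rule: pres_eq.induct)
  case (cancel u a b v)
  show ?case using pres_eq.cancel[of Rels "x @ u" a b "v @ y"] by simp
next
  case (relator r u v)
  then show ?case using pres_eq.relator[of r Rels "x @ u" "v @ y"] by simp
qed (auto intro: pres_eq.refl pres_eq.sym pres_eq.trans)

lemma pres_eq_append:
  assumes "pres_eq Rels u u'" and "pres_eq Rels v v'"
  shows "pres_eq Rels (u @ v) (u' @ v')"
  using pres_eq_append_context[OF assms(1), of "[]" v]
    pres_eq_append_context[OF assms(2), of u' "[]"]
  by (auto intro: pres_eq.trans)

lemma presented_group_mult:
  "(pres_rel Rels `` {u}) \<otimes>\<^bsub>presented_group Rels\<^esub> (pres_rel Rels `` {v})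
     = pres_rel Rels `` {u @ v}"
proof -
  have "congruent2 (pres_rel Rels) (pres_rel Rels) (\<lambda>u v. pres_rel Rels `` {u @ v})"
    by (rule congruent2I')
      (auto simp: pres_rel_def intro: pres_eq.trans pres_eq.sym pres_eq_append)
  then show ?thesis
    using UN_equiv_class2[OF equiv_pres_rel equiv_pres_rel]
    by (fastforce simp: presented_group_def)
qed

lemma pres_eq_inverse: "pres_eq Rels (rev (map (\<lambda>(a, b). (a, \<not> b)) u) @ u) []"
proof (induction u)
  case (Cons c u)
  obtain a b where c: "c = (a, b)" by (cases c)
  show ?case
    using pres_eq.cancel[of Rels "rev (map (\<lambda>(a, b). (a, \<not> b)) u)" a "\<not> b" u] Cons
    by (auto simp: c intro: pres_eq.trans)
qed (simp add: pres_eq.refl)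

lemma group_presented_group: "group (presented_group Rels)"
proof -
  let ?G = "presented_group Rels"
  have car: "\<exists>u. x = pres_rel Rels `` {u}" if "x \<in> carrier ?G" for x
    using that by (auto simp: presented_group_def elim: quotientE)
  have cls: "pres_rel Rels `` {u} \<in> carrier ?G" for u
    by (simp add: presented_group_def quotientI)
  have one: "\<one>\<^bsub>?G\<^esub> = pres_rel Rels `` {[]}"
    by (simp add: presented_group_def)
  show ?thesis
  proof (rule groupI)
    show "\<one>\<^bsub>?G\<^esub> \<in> carrier ?G" by (simp add: one cls)
  next
    fix x y assume "x \<in> carrier ?G" "y \<in> carrier ?G"
    then show "x \<otimes>\<^bsub>?G\<^esub> y \<in> carrier ?G"
      using car[of x] car[of y] by (auto simp: presented_group_mult cls)
  next
    fix x y z assume "x \<in> carrier ?G" "y \<in> carrier ?G" "z \<in> carrier ?G"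
    then show "x \<otimes>\<^bsub>?G\<^esub> y \<otimes>\<^bsub>?G\<^esub> z = x \<otimes>\<^bsub>?G\<^esub> (y \<otimes>\<^bsub>?G\<^esub> z)"
      using car[of x] car[of y] car[of z] by (auto simp: presented_group_mult)
  next
    fix x assume "x \<in> carrier ?G"
    then show "\<one>\<^bsub>?G\<^esub> \<otimes>\<^bsub>?G\<^esub> x = x"
      using car[of x] by (auto simp: presented_group_mult one)
  next
    fix x assume "x \<in> carrier ?G"
    then obtain u where u: "x = pres_rel Rels `` {u}" using car by blast
    let ?v = "rev (map (\<lambda>(a, b). (a, \<not> b)) u)"
    have "pres_rel Rels `` {?v @ u} = pres_rel Rels `` {[]}"
      by (rule equiv_class_eq[OF equiv_pres_rel]) (simp add: pres_rel_def pres_eq_inverse)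
    then have "pres_rel Rels `` {?v} \<otimes>\<^bsub>?G\<^esub> x = \<one>\<^bsub>?G\<^esub>"
      by (simp only: u one presented_group_mult)
    then show "\<exists>y\<in>carrier ?G. y \<otimes>\<^bsub>?G\<^esub> x = \<one>\<^bsub>?G\<^esub>"
      using cls[of ?v] by blast
  qed
qed


section \<open>Inversion complete subsets\<close>

text \<open>In a Coxeter system the generators are involutions, so only words in \<open>S\<close> are needed.\<close>

definition cox_length :: "('g, 'b) monoid_scheme \<Rightarrow> 'g set \<Rightarrow> 'g \<Rightarrow> nat" where
  "cox_length W S w =
     (LEAST n. \<exists>ss. set ss \<subseteq> S \<and> length ss = n \<and> foldr (mult W) ss \<one>\<^bsub>W\<^esub> = w)"

definition reflections :: "('g, 'b) monoid_scheme \<Rightarrow> 'g set \<Rightarrow> 'g set" where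
  "reflections W S = (\<Union>w\<in>carrier W. \<Union>s\<in>S. {w \<otimes>\<^bsub>W\<^esub> s \<otimes>\<^bsub>W\<^esub> inv\<^bsub>W\<^esub> w})"

definition inversions :: "('g, 'b) monoid_scheme \<Rightarrow> 'g set \<Rightarrow> 'g \<Rightarrow> 'g set" where
  "inversions W S w =
     {t \<in> reflections W S. cox_length W S (w \<otimes>\<^bsub>W\<^esub> t) < cox_length W S w}"

definition inversion_complete :: "('g, 'b) monoid_scheme \<Rightarrow> 'g set \<Rightarrow> 'g set \<Rightarrow> bool" where
  "inversion_complete W S Y \<longleftrightarrow>
     Y \<subseteq> carrier W \<and> (\<Union>w\<in>Y. inversions W S w) = reflections W S"

definition minimal_inversion_complete ::
    "('g, 'b) monoid_scheme \<Rightarrow> 'g set \<Rightarrow> 'g set \<Rightarrow> bool" where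
  "minimal_inversion_complete W S Y \<longleftrightarrow>
     inversion_complete W S Y \<and> (\<forall>Z. Z \<subset> Y \<longrightarrow> \<not> inversion_complete W S Z)"

text \<open>The maximum is meaningful only for finite \<open>W\<close>.\<close>

definition MC :: "('g, 'b) monoid_scheme \<Rightarrow> 'g set \<Rightarrow> nat" where
  "MC W S = Max {card Y | Y. minimal_inversion_complete W S Y}"


section \<open>The Coxeter system of type \<open>H\<^sub>4\<close>\<close>

datatype h4_gen = S1 | S2 | S3 | S4

definition power_relator :: "'a list \<Rightarrow> nat \<Rightarrow> 'a gword" where
  "power_relator as k = concat (replicate k (map (\<lambda>a. (a, True)) as))"

definition h4_relators :: "h4_gen gword set" where
  "h4_relators =
     {power_relator [S1] 2, power_relator [S2] 2, power_relator [S3] 2, power_relator [S4] 2,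
      power_relator [S1, S2] 5, power_relator [S2, S3] 3, power_relator [S3, S4] 3,
      power_relator [S1, S3] 2, power_relator [S1, S4] 2, power_relator [S2, S4] 2}"

definition H4 :: "h4_gen gword set monoid" where
  "H4 = presented_group h4_relators"

definition H4_gens :: "h4_gen gword set set" where
  "H4_gens = range (pres_gen h4_relators)"

end

(*
  H4 acts on its 60 positive roots up to sign. Every positive root is assigned a palindromic word
  for its reflection, and these words are permuted by conjugation in the presented group exactly
  as the roots are: a descent of a root is obtained from shallower ones by going around its orbit
  under a rank 2 parabolic subgroup, where the Coxeter relation closes the circuit. A deletion
  argument then shows that the inversions of w are the reflections whose positive roots w makes
  negative, so that inversion sets can be computed from the permutation of the roots. The 8
  witness words, found by computer search, jointly invert all 60 reflections, and each of them
  inverts a reflection that none of the others inverts.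
*)

theory Submission
  imports Defs
begin

section \<open>The action on roots\<close>

fun simple_root :: "h4_gen \<Rightarrow> nat" where
  "simple_root S1 = 0"
| "simple_root S2 = 1"
| "simple_root S3 = 2"
| "simple_root S4 = 3"

text \<open>
  The 60 positive roots are numbered by non-decreasing depth; entry \<open>i\<close> of the row of \<open>g\<close> is the
  number of the positive root proportional to the image of root \<open>i\<close> under \<open>g\<close>.
\<close>

fun root_table :: "h4_gen \<Rightarrow> nat list" where
  "root_table S1 =
   [0, 5, 2, 3, 8, 1, 10, 7, 4, 12, 6, 15, 9, 17, 18, 11, 20, 13, 14, 22,
    16, 25, 19, 27, 24, 21, 29, 23, 28, 26, 33, 31, 35, 30, 37, 32, 36, 34, 38, 39,
    43, 41, 42, 40, 46, 45, 44, 49, 50, 47, 48, 52, 51, 54, 53, 56, 55, 57, 58, 59]"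
| "root_table S2 =
   [4, 1, 6, 3, 0, 8, 2, 11, 5, 9, 14, 7, 16, 13, 10, 19, 12, 21, 18, 15,
    24, 17, 22, 23, 20, 28, 26, 30, 25, 32, 27, 34, 29, 36, 31, 38, 33, 40, 35, 39,
    37, 44, 42, 43, 41, 47, 48, 45, 46, 51, 50, 49, 52, 53, 55, 54, 57, 56, 58, 59]"
| "root_table S3 =
   [0, 6, 2, 7, 9, 10, 1, 3, 12, 4, 5, 11, 8, 13, 16, 15, 14, 17, 20, 23,
    18, 26, 27, 19, 24, 29, 21, 22, 31, 25, 30, 28, 34, 33, 32, 37, 39, 35, 41, 36,
    44, 38, 45, 46, 40, 42, 43, 47, 48, 49, 50, 53, 54, 51, 52, 55, 56, 58, 57, 59]"
| "root_table S4 =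
   [0, 1, 7, 3, 4, 5, 11, 2, 8, 13, 15, 6, 17, 9, 19, 10, 21, 12, 22, 14,
    25, 16, 18, 26, 28, 20, 23, 29, 24, 27, 32, 31, 30, 35, 34, 33, 38, 37, 36, 42,
    40, 45, 39, 43, 47, 41, 49, 44, 51, 46, 52, 48, 50, 53, 54, 55, 56, 57, 59, 58]"

definition act :: "h4_gen \<Rightarrow> nat \<Rightarrow> nat" where
  "act g i = root_table g ! i"

text \<open>Whether the word \<open>w\<close> maps the positive root number \<open>i\<close> to a negative root.\<close>

primrec neg :: "h4_gen list \<Rightarrow> nat \<Rightarrow> bool" where
  "neg [] i \<longleftrightarrow> False"
| "neg (g # w) i \<longleftrightarrow> neg w i \<noteq> (foldr act w i = simple_root g)"

fun coxeter_m :: "h4_gen \<Rightarrow> h4_gen \<Rightarrow> nat" where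
  "coxeter_m S1 S2 = 5" | "coxeter_m S2 S1 = 5"
| "coxeter_m S2 S3 = 3" | "coxeter_m S3 S2 = 3"
| "coxeter_m S3 S4 = 3" | "coxeter_m S4 S3 = 3"
| "coxeter_m g h = (if g = h then 1 else 2)"

text \<open>The word \<open>cox_word g g\<close> is the relator \<open>g\<^sup>2\<close>.\<close>

definition cox_word :: "h4_gen \<Rightarrow> h4_gen \<Rightarrow> h4_gen list" where
  "cox_word g h = concat (replicate (coxeter_m g h) [g, h])"

definition gens :: "h4_gen list" where "gens = [S1, S2, S3, S4]"

lemma set_gens [simp]: "set gens = UNIV"
  unfolding gens_def using h4_gen.exhaust by auto

lemma gens_nth_simple_root [simp]: "gens ! simple_root g = g"
  by (cases g) (simp_all add: gens_def)

lemma act_map: "map (act g) [0..<60] = root_table g"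
proof -
  have "length (root_table g) = 60"
    by (cases g) simp_all
  then show ?thesis
    using map_nth[of "root_table g"] by (simp add: act_def[abs_def])
qed

lemma upt_60:
  "[0..<60] =
     [0, 1, 2, 3, 4, 5, 6, 7, 8, 9, 10, 11, 12, 13, 14, 15, 16, 17, 18, 19,
      20, 21, 22, 23, 24, 25, 26, 27, 28, 29, 30, 31, 32, 33, 34, 35, 36, 37, 38, 39,
      40, 41, 42, 43, 44, 45, 46, 47, 48, 49, 50, 51, 52, 53, 54, 55, 56, 57, 58, 59]"
  by (simp add: upt_conv_Cons)

text \<open>Yields one rewrite rule per table entry, so that the finite checks run in the simplifier
  without list lookups.\<close>

lemmas act_simps =
  act_map[of S1, unfolded upt_60 root_table.simps list.map list.inject One_nat_def simp_thms]
  act_map[of S2, unfolded upt_60 root_table.simps list.map list.inject One_nat_def simp_thms]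
  act_map[of S3, unfolded upt_60 root_table.simps list.map list.inject One_nat_def simp_thms]
  act_map[of S4, unfolded upt_60 root_table.simps list.map list.inject One_nat_def simp_thms]

text \<open>Reads a word from the letter applied first and carries the current root along, whereas
  \<open>neg\<close> recomputes \<open>foldr act w i\<close> at each letter.\<close>

primrec flips :: "h4_gen list \<Rightarrow> nat \<Rightarrow> bool" where
  "flips [] i \<longleftrightarrow> False"
| "flips (g # w) i \<longleftrightarrow> (i = simple_root g) \<noteq> flips w (act g i)"

lemma act_check:
  "list_all (\<lambda>g. simple_root g < 60 \<and> act g (simple_root g) = simple_root g \<and>
     list_all (\<lambda>i. act g i < 60 \<and> act g (act g i) = i) [0..<60]) gens"
  by (simp add: gens_def upt_60 act_simps)

lemma act_less [simp]: "i < 60 \<Longrightarrow> act g i < 60"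
  and act_act [simp]: "i < 60 \<Longrightarrow> act g (act g i) = i"
  and simple_root_less [simp]: "simple_root g < 60"
  and act_simple_root [simp]: "act g (simple_root g) = simple_root g"
  using act_check by (auto simp: list_all_iff)

lemma act_eq_simple_root_iff [simp]: "i < 60 \<Longrightarrow> act g i = simple_root g \<longleftrightarrow> i = simple_root g"
  by (metis act_act act_simple_root)

lemma foldr_act_less [simp]: "i < 60 \<Longrightarrow> foldr act w i < 60"
  by (induction w) auto

lemma neg_append [simp]: "neg (u @ v) i \<longleftrightarrow> neg v i \<noteq> neg u (foldr act v i)"
  by (induction u) auto

text \<open>In contrast to the definition, this is evaluated in linear time.\<close>

lemma neg_eq_flips: "neg w i \<longleftrightarrow> flips (rev w) i"
proof -
  have "flips w i \<longleftrightarrow> neg (rev w) i" for w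
    by (induction w arbitrary: i) auto
  then show ?thesis
    by simp
qed

lemma replicate_small:
  "replicate 2 x = [x, x]" "replicate 3 x = [x, x, x]" "replicate 5 x = [x, x, x, x, x]"
  by (simp_all add: numeral_eq_Suc)

text \<open>The tables respect the Coxeter relations, signs included; this lets \<open>act\<close>
  and \<open>neg\<close> descend from words to group elements.\<close>

lemma cox_word_check:
  "list_all (\<lambda>g. list_all (\<lambda>h. list_all (\<lambda>i.
     foldr act (cox_word g h) i = i \<and> \<not> neg (cox_word g h) i) [0..<60]) gens) gens"
  by (simp add: gens_def upt_60 act_simps cox_word_def replicate_small)

lemma foldr_act_cox_word [simp]: "i < 60 \<Longrightarrow> foldr act (cox_word g h) i = i"
  and neg_cox_word [simp]: "i < 60 \<Longrightarrow> \<not> neg (cox_word g h) i"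
  using cox_word_check by (auto simp: list_all_iff)


section \<open>Equivalence of words in the generators\<close>

definition letters :: "h4_gen list \<Rightarrow> h4_gen gword" where
  "letters w = map (\<lambda>g. (g, True)) w"

lemma letters_simps [simp]:
  "letters [] = []" "letters (g # w) = (g, True) # letters w"
  "letters (u @ v) = letters u @ letters v" "map fst (letters w) = w"
  by (simp_all add: letters_def o_def)

definition weq :: "h4_gen list \<Rightarrow> h4_gen list \<Rightarrow> bool"  (infix "\<approx>" 50) where
  "u \<approx> v \<longleftrightarrow> pres_eq h4_relators (letters u) (letters v)"

lemma weq_refl [simp]: "u \<approx> u"
  by (simp add: weq_def pres_eq.refl)

lemma weq_sym: "u \<approx> v \<Longrightarrow> v \<approx> u"
  unfolding weq_def by (rule pres_eq.sym)

lemma weq_trans [trans]: "u \<approx> v \<Longrightarrow> v \<approx> w \<Longrightarrow> u \<approx> w"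
  unfolding weq_def by (rule pres_eq.trans)

lemma weq_append: "u \<approx> u' \<Longrightarrow> v \<approx> v' \<Longrightarrow> u @ v \<approx> u' @ v'"
  unfolding weq_def by (simp add: pres_eq_append)

lemma weq_context: "u \<approx> v \<Longrightarrow> x @ u @ y \<approx> x @ v @ y"
  by (simp add: weq_append)

lemma weq_relator: "letters u \<in> h4_relators \<Longrightarrow> u \<approx> []"
  using pres_eq.relator[of "letters u" h4_relators "[]" "[]"] by (simp add: weq_def)

lemma weq_square: "[g, g] \<approx> []"
  by (rule weq_relator, cases g) (simp_all add: h4_relators_def power_relator_def replicate_small)

lemma weq_append_rev: "w @ rev w \<approx> []"
proof (induction w)
  case (Cons g w)
  have "(g # w) @ rev (g # w) \<approx> [g] @ [] @ [g]"
    using weq_context[OF Cons, of "[g]" "[g]"] by simp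
  also have "[g] @ [] @ [g] \<approx> []"
    using weq_square by simp
  finally show ?case .
qed simp

lemma weq_rev_append: "rev w @ w \<approx> []"
  using weq_append_rev[of "rev w"] by simp

lemma weq_rev_if_append_left:
  assumes "u @ v \<approx> []"
  shows "u \<approx> rev v"
proof -
  have "u \<approx> u @ v @ rev v"
    using weq_sym[OF weq_context[OF weq_append_rev, of u v "[]"]] by simp
  also have "u @ v @ rev v \<approx> rev v"
    using weq_append[OF assms weq_refl, of "rev v"] by simp
  finally show ?thesis .
qed

lemma weq_rev_if_append_right:
  assumes "u @ v \<approx> []"
  shows "v \<approx> rev u"
proof -
  have "v \<approx> (rev u @ u) @ v"
    using weq_sym[OF weq_append[OF weq_rev_append weq_refl]] by simp
  also have "(rev u @ u) @ v \<approx> rev u"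
    using weq_append[OF weq_refl assms] by simp
  finally show ?thesis .
qed

lemma weq_rev:
  assumes "u \<approx> v"
  shows "rev u \<approx> rev v"
proof -
  have "u @ rev v \<approx> v @ rev v"
    using assms by (simp add: weq_append)
  also have "v @ rev v \<approx> []"
    by (rule weq_append_rev)
  finally show ?thesis
    by (intro weq_sym[OF weq_rev_if_append_right])
qed

text \<open>For distinct \<open>g\<close> and \<open>h\<close> only one order is a relator; the
  other word is its reversal, which represents the inverse.\<close>

lemma weq_cox_word: "cox_word g h \<approx> []"
proof -
  have rel: "letters (cox_word g h) \<in> h4_relators \<or> letters (cox_word h g) \<in> h4_relators"
    by (cases g; cases h)
      (simp_all add: cox_word_def h4_relators_def power_relator_def replicate_small)
  have "rev (cox_word h g) = cox_word g h"
    by (cases g; cases h) (simp_all add: cox_word_def replicate_small)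
  moreover have "rev (cox_word h g) \<approx> []" if "cox_word h g \<approx> []"
    using weq_rev_if_append_left[of "[]" "cox_word h g"] weq_sym that by simp
  ultimately show ?thesis
    using rel weq_relator by metis
qed

lemma
  assumes "u \<approx> v" "i < 60"
  shows weq_foldr_act: "foldr act u i = foldr act v i"
    and weq_neg: "neg u i = neg v i"
proof -
  have ex_gen: "(\<exists>g. P g) \<longleftrightarrow> P S1 \<or> P S2 \<or> P S3 \<or> P S4" for P
    by (metis h4_gen.exhaust)
  \<comment> \<open>A derivation may pass through formal inverses. Forgetting exponents is harmless
    because every generator acts as an involution and two equal letters in a row change the sign
    twice or not at all.\<close>
  have *: "foldr act (map fst u) i = foldr act (map fst v) i \<and>
      neg (map fst u) i = neg (map fst v) i"
    if "pres_eq h4_relators u v" "i < 60" for u v i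
    using that
  proof (induction arbitrary: i rule: pres_eq.induct)
    case (relator r u v)
    have "\<exists>g h. map fst r = cox_word g h"
      using relator(1) unfolding h4_relators_def
      by (elim insertE emptyE; simp add: ex_gen power_relator_def cox_word_def replicate_small)
    then obtain g h where "map fst r = cox_word g h"
      by auto
    then show ?case
      using relator by simp
  qed auto
  show "foldr act u i = foldr act v i" "neg u i = neg v i"
    using *[of "letters u" "letters v" i] assms by (auto simp: weq_def)
qed


section \<open>Reflections\<close>

text \<open>Conjugates down towards a simple root: as numbers follow depth, a generator that lowers
  the number leads to a parent. \<open>None\<close> marks the simple roots, whose numbers index
  \<open>gens\<close>.\<close>

function root_word :: "nat \<Rightarrow> h4_gen list" where
  "root_word i =
     (case find (\<lambda>g. act g i < i) gens of
        None \<Rightarrow> [gens ! i]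
      | Some g \<Rightarrow> g # root_word (act g i) @ [g])"
  by pat_completeness auto
termination
  by (relation "measure id") (auto simp: find_Some_iff)

declare root_word.simps [simp del]

primrec path_ok :: "(h4_gen \<Rightarrow> nat \<Rightarrow> bool) \<Rightarrow> h4_gen list \<Rightarrow> nat \<Rightarrow> bool" where
  "path_ok P [] i \<longleftrightarrow> True"
| "path_ok P (g # w) i \<longleftrightarrow> path_ok P w i \<and> P g (foldr act w i)"

text \<open>Stated relative to a set \<open>P\<close> of edges already settled, so that it serves
  inside the induction over roots as well as after it.\<close>

lemma path_ok_conj:
  assumes "\<And>g j. P g j \<Longrightarrow> j < 60 \<Longrightarrow> g # root_word j @ [g] \<approx> root_word (act g j)"
    and "path_ok P w i" "i < 60"
  shows "w @ root_word i @ rev w \<approx> root_word (foldr act w i)"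
  using assms(2)
proof (induction w)
  case (Cons g w)
  have "(g # w) @ root_word i @ rev (g # w) \<approx> [g] @ root_word (foldr act w i) @ [g]"
    using weq_context[OF Cons.IH, of "[g]" "[g]"] Cons.prems by simp
  also have "\<dots> \<approx> root_word (foldr act (g # w) i)"
    using assms(1)[of g "foldr act w i"] assms(3) Cons.prems by simp
  finally show ?case .
qed simp

text \<open>
  The edges that may be used to derive a descent at \<open>i\<close> whose parent lies along \<open>g\<close>: those between
  roots numbered below \<open>i\<close>, and the edge from \<open>i\<close> to its parent.
\<close>

definition edge_ok :: "nat \<Rightarrow> h4_gen \<Rightarrow> h4_gen \<Rightarrow> nat \<Rightarrow> bool" where
  "edge_ok i g h j \<longleftrightarrow> j < i \<and> act h j < i \<or> h = g \<and> (j = i \<or> act g j = i)"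

text \<open>
  The word \<open>tl (cox_word h g)\<close> equals \<open>h\<close> in the group and leaves \<open>i\<close> along \<open>g\<close>. The three
  exceptions are the highest roots of the rank 2 parabolic subsystems of type \<open>A\<^sub>2\<close> and
  \<open>I\<^sub>2(5)\<close>, where this circuit uses the edge in question twice.
\<close>

lemma descent_check:
  "list_all (\<lambda>i. case find (\<lambda>g. act g i < i) gens of
     None \<Rightarrow> i = simple_root (gens ! i) \<and>
       list_all (\<lambda>h. act h i \<le> i \<longrightarrow>
         act h i = i \<and> (h = gens ! i \<or> coxeter_m h (gens ! i) = 2)) gens
   | Some g \<Rightarrow> list_all (\<lambda>h. h \<noteq> g \<longrightarrow> act h i \<le> i \<longrightarrow>
       path_ok (edge_ok i g) (tl (cox_word h g)) i \<or>
       (h, i) \<in> {(S3, 6), (S4, 7), (S2, 8)}) gens) [0..<60]"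
  by (simp add: gens_def upt_60 act_simps cox_word_def replicate_small edge_ok_def)

lemma root_word_simple_root [simp]: "root_word (simple_root g) = [g]"
  by (cases g) (simp_all add: root_word.simps gens_def act_simps)

lemma root_word_small:
  "root_word (Suc 0) = [S2]" "root_word 2 = [S3]" "root_word 5 = [S1, S2, S1]"
  "root_word 6 = [S2, S3, S2]" "root_word 7 = [S3, S4, S3]" "root_word 8 = [S1, S2, S1, S2, S1]"
  by (simp_all add: root_word.simps gens_def act_simps)

text \<open>Conjugation by \<open>g\<close> is an involution modulo \<open>\<approx>\<close>, so an
  edge settled in one direction is settled in both.\<close>

lemma weq_conj_flip:
  assumes "g # u @ [g] \<approx> v"
  shows "g # v @ [g] \<approx> u"
proof -
  have "g # v @ [g] \<approx> [g, g] @ u @ [g, g]"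
    using weq_context[OF weq_sym[OF assms], of "[g]" "[g]"] by simp
  also have "[g, g] @ u @ [g, g] \<approx> [] @ u @ []"
    by (intro weq_append weq_square weq_refl)
  finally show ?thesis by simp
qed

lemma weq_tl_cox_word: "tl (cox_word g h) \<approx> [g]"
proof -
  have "cox_word g h = [g] @ tl (cox_word g h)"
    by (cases g; cases h) (simp_all add: cox_word_def replicate_small)
  then have "[g] @ tl (cox_word g h) \<approx> []"
    using weq_cox_word[of g h] by simp
  then show ?thesis
    using weq_rev_if_append_right by fastforce
qed

lemma weq_conj_root_word:
  assumes "i < 60"
  shows "g # root_word i @ [g] \<approx> root_word (act g i)"
proof -
  \<comment> \<open>Restricting to generators that do not raise the root makes induction on its
    number possible; ascents are recovered at the end.\<close>
  have step: "\<forall>h. act h i \<le> i \<longrightarrow> h # root_word i @ [h] \<approx> root_word (act h i)" if "i < 60" for i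
    using that
  proof (induction i rule: less_induct)
    case (less i)
    have below: "h # root_word j @ [h] \<approx> root_word (act h j)" if "j < i" "act h j < i" for h j
    proof (cases "act h j \<le> j")
      case True
      then show ?thesis using less that by simp
    next
      case False
      then have "h # root_word (act h j) @ [h] \<approx> root_word j"
        using less.IH[of "act h j"] less.prems that
        by (metis act_act linear order.strict_trans)
      then show ?thesis by (rule weq_conj_flip)
    qed
    show ?case
    proof (cases "find (\<lambda>g. act g i < i) gens")
      case None
      then have rw: "root_word i = [gens ! i]"
        by (simp add: root_word.simps)
      show ?thesis
      proof (intro allI impI)
        fix h assume h: "act h i \<le> i"
        let ?k = "gens ! i"
        \<comment> \<open>At a simple root only its own generator and those commuting with it fail
          to raise the number.\<close>
        have act_h: "act h i = i" and hk: "h = ?k \<or> coxeter_m h ?k = 2"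
          using bspec[OF descent_check[unfolded list_all_iff], of i] less.prems None h by auto
        from hk have "[h, ?k, h] \<approx> [?k]"
        proof
          assume "h = ?k"
          then show ?thesis
            using weq_context[OF weq_square, of "[]" h "[h]"] by simp
        next
          assume "coxeter_m h ?k = 2"
          then have "cox_word h ?k = [h, ?k, h] @ [?k]"
            by (simp add: cox_word_def replicate_small)
          then show ?thesis
            using weq_cox_word[of h ?k] weq_rev_if_append_left[of "[h, ?k, h]" "[?k]"] by simp
        qed
        then show "h # root_word i @ [h] \<approx> root_word (act h i)"
          using rw act_h by simp
      qed
    next
      case (Some g)
      have g: "g # root_word i @ [g] \<approx> root_word (act g i)"
        by (rule weq_conj_flip) (simp add: root_word.simps[of i] Some)
      have edge: "h # root_word j @ [h] \<approx> root_word (act h j)"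
        if "edge_ok i g h j" "j < 60" for h j
        using that below g weq_conj_flip[OF g] less.prems by (auto simp: edge_ok_def)
      \<comment> \<open>In each exception the whole relator \<open>cox_word\<close> factors as
        \<open>h # root_word i @ [h]\<close> followed by the palindrome
        \<open>root_word (act h i)\<close>, so the relation itself gives the claim.\<close>
      have special: "h # root_word i @ [h] \<approx> root_word (act h i)"
        if "(h, i) \<in> {(S3, 6), (S4, 7), (S2, 8)}" for h
        using that
          weq_rev_if_append_left[of "[S3, S2, S3, S2, S3]" "[S2]"] weq_cox_word[of S3 S2]
          weq_rev_if_append_left[of "[S4, S3, S4, S3, S4]" "[S3]"] weq_cox_word[of S4 S3]
          weq_rev_if_append_left[of "[S2, S1, S2, S1, S2, S1, S2]" "[S1, S2, S1]"] weq_cox_word[of S2 S1]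
        by (auto simp: cox_word_def replicate_small root_word_small act_simps)
      show ?thesis
      proof (intro allI impI)
        fix h assume h: "act h i \<le> i"
        let ?w = "tl (cox_word h g)"
        consider "h = g" | "path_ok (edge_ok i g) ?w i" | "(h, i) \<in> {(S3, 6), (S4, 7), (S2, 8)}"
          using bspec[OF descent_check[unfolded list_all_iff], of i] less.prems Some h by auto
        then show "h # root_word i @ [h] \<approx> root_word (act h i)"
        proof cases
          case 2
          have w: "?w \<approx> [h]" by (rule weq_tl_cox_word)
          have "[h] @ root_word i @ [h] \<approx> ?w @ root_word i @ rev ?w"
            using weq_rev[OF weq_sym[OF w]] weq_sym[OF w] by (intro weq_append weq_refl) simp_all
          also have "\<dots> \<approx> root_word (foldr act ?w i)"
            using path_ok_conj[OF edge 2 less.prems] .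
          also have "foldr act ?w i = act h i"
            using weq_foldr_act[OF w less.prems] by simp
          finally show ?thesis by simp
        qed (use g special in auto)
      qed
    qed
  qed
  show ?thesis
  proof (cases "act g i \<le> i")
    \<comment> \<open>An ascent from \<open>i\<close> is a descent from \<open>act g i\<close>,
      traversed backwards.\<close>
    case False
    then have "g # root_word (act g i) @ [g] \<approx> root_word i"
      using step[of "act g i"] assms by (metis act_act act_less linear)
    then show ?thesis by (rule weq_conj_flip)
  qed (use step assms in blast)
qed

lemma weq_conj_root_word_foldr:
  assumes "i < 60"
  shows "w @ root_word i @ rev w \<approx> root_word (foldr act w i)"
proof -
  have "path_ok (\<lambda>_ _. True) w i"
    by (induction w) auto
  then show ?thesis
    using path_ok_conj[of "\<lambda>_ _. True" w i] weq_conj_root_word assms by blast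
qed

text \<open>A reflection negates its own root. In the recursion neither outer copy of
  \<open>g\<close> meets its simple root, so the sign comes from the inner word.\<close>

lemma act_neg_root_word:
  "i < 60 \<Longrightarrow> foldr act (root_word i) i = i \<and> neg (root_word i) i"
proof (induction i rule: root_word.induct)
  case (1 i)
  show ?case
  proof (cases "find (\<lambda>g. act g i < i) gens")
    case None
    then have "i = simple_root (gens ! i)"
      using descent_check 1(2) by (force simp: list_all_iff)
    moreover from None have "root_word i = [gens ! i]"
      by (simp add: root_word.simps)
    ultimately show ?thesis
      using act_simple_root[of "gens ! i"] by simp
  next
    case (Some g)
    then have "act g i < i"
      by (auto simp: find_Some_iff)
    then show ?thesis
      using 1 Some by (auto simp: root_word.simps[of i])
  qed
qed

lemma root_word_conj_simple: "i < 60 \<Longrightarrow> \<exists>x g. root_word i = x @ [g] @ rev x"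
proof (induction i rule: root_word.induct)
  case (1 i)
  show ?case
  proof (cases "find (\<lambda>g. act g i < i) gens")
    case None
    then show ?thesis by (intro exI[of _ "[]"]) (auto simp: root_word.simps[of i])
  next
    case (Some g)
    then obtain x h where "root_word (act g i) = x @ [h] @ rev x"
      using 1 by auto
    then have "root_word i = (g # x) @ [h] @ rev (g # x)"
      using Some by (simp add: root_word.simps[of i])
    then show ?thesis by blast
  qed
qed

lemma weq_root_word_square: "i < 60 \<Longrightarrow> root_word i @ root_word i \<approx> []"
  using root_word_conj_simple[of i] weq_append_rev[of "root_word i"] by auto


section \<open>Length and inversions\<close>

definition word_length :: "h4_gen list \<Rightarrow> nat" where
  "word_length w = (LEAST n. \<exists>v. length v = n \<and> v \<approx> w)"

lemma word_length_le: "v \<approx> w \<Longrightarrow> word_length w \<le> length v"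
  unfolding word_length_def by (rule Least_le) auto

lemma word_length_witness: "\<exists>v. length v = word_length w \<and> v \<approx> w"
  unfolding word_length_def by (rule LeastI_ex) (use weq_refl in blast)

lemma word_length_cong: "u \<approx> v \<Longrightarrow> word_length u = word_length v"
  by (metis le_antisym weq_sym weq_trans word_length_le word_length_witness)

text \<open>The sign changes exactly at letters that meet their own simple root, and a negative
  result needs at least one such letter.\<close>

lemma neg_split: "neg w i \<Longrightarrow> \<exists>x g y. w = x @ g # y \<and> foldr act y i = simple_root g"
proof (induction w)
  case (Cons h w)
  show ?case
  proof (cases "neg w i")
    case True
    then show ?thesis using Cons.IH by (metis append_Cons)
  next
    case False
    then show ?thesis using Cons.prems by (intro exI[of _ "[]"]) auto
  qed
qed simp

text \<open>Strong exchange: in a reduced word \<open>x @ g # y\<close> for \<open>w\<close>, the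
  suffix \<open>y\<close> conjugates the reflection to \<open>g\<close>, so multiplying by the
  reflection deletes this \<open>g\<close>.\<close>

lemma word_length_less_if_neg:
  assumes "neg w i" "i < 60"
  shows "word_length (w @ root_word i) < word_length w"
proof -
  obtain v where v: "length v = word_length w" "v \<approx> w"
    using word_length_witness by blast
  then have "neg v i"
    using assms weq_neg by blast
  then obtain x g y where xgy: "v = x @ g # y" "foldr act y i = simple_root g"
    using neg_split by blast
  have "w @ root_word i \<approx> (x @ [g] @ y) @ root_word i @ []"
    using weq_append[OF weq_sym[OF v(2)] weq_refl, of "root_word i"] xgy by simp
  \<comment> \<open>Inserting \<open>rev y @ y\<close> exposes the conjugate of the reflection by
    \<open>y\<close>, which is \<open>g\<close>.\<close>
  also have "\<dots> \<approx> (x @ [g] @ y) @ root_word i @ (rev y @ y)"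
    by (intro weq_append weq_refl weq_sym[OF weq_rev_append])
  also have "\<dots> = (x @ [g]) @ (y @ root_word i @ rev y) @ y"
    by simp
  also have "\<dots> \<approx> (x @ [g]) @ [g] @ y"
    using weq_conj_root_word_foldr[OF assms(2), of y] xgy(2) by (intro weq_context) simp
  also have "\<dots> = x @ [g, g] @ y"
    by simp
  also have "\<dots> \<approx> x @ [] @ y"
    by (intro weq_context weq_square)
  finally have "w @ root_word i \<approx> x @ [] @ y" .
  then have "word_length (w @ root_word i) \<le> length (x @ [] @ y)"
    by (rule word_length_le[OF weq_sym])
  then show ?thesis
    using v(1) xgy(1) by simp
qed

lemma word_length_less_iff:
  assumes "i < 60"
  shows "word_length (w @ root_word i) < word_length w \<longleftrightarrow> neg w i"
proof
  assume less: "word_length (w @ root_word i) < word_length w"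
  show "neg w i"
  proof (rule ccontr)
    assume "\<not> neg w i"
    \<comment> \<open>The reflection first negates root \<open>i\<close>, which \<open>w\<close>
      then keeps negative; the exchange argument for this product would make \<open>w\<close> the
      shorter one.\<close>
    then have "neg (w @ root_word i) i"
      using act_neg_root_word[OF assms] by simp
    from word_length_less_if_neg[OF this assms]
    have "word_length (w @ root_word i @ root_word i) < word_length (w @ root_word i)"
      by simp
    moreover have "word_length (w @ root_word i @ root_word i) = word_length w"
      using word_length_cong weq_append[OF weq_refl weq_root_word_square[OF assms], of w] by auto
    ultimately show False
      using less by simp
  qed
qed (use word_length_less_if_neg assms in blast)


section \<open>Passage to the presented group\<close>

definition elt :: "h4_gen list \<Rightarrow> h4_gen gword set" where
  "elt w = pres_rel h4_relators `` {letters w}"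

lemma elt_eq_iff: "elt u = elt v \<longleftrightarrow> u \<approx> v"
  by (simp add: elt_def weq_def eq_equiv_class_iff[OF equiv_pres_rel]) (simp add: pres_rel_def)

lemma elt_mult: "elt u \<otimes>\<^bsub>H4\<^esub> elt v = elt (u @ v)"
  by (simp add: elt_def H4_def presented_group_mult)

lemma elt_one: "\<one>\<^bsub>H4\<^esub> = elt []"
  by (simp add: elt_def H4_def presented_group_def)

lemma elt_carrier: "elt w \<in> carrier H4"
  by (simp add: elt_def H4_def presented_group_def quotientI)

text \<open>Generators are their own inverses, so every class contains a word without formal
  inverses; hence \<open>elt\<close> reaches the whole group.\<close>

lemma pres_eq_letters: "pres_eq h4_relators u (letters (map fst u))"
proof (induction u)
  case (Cons a u)
  obtain g b where a: "a = (g, b)" by (cases a)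
  have "pres_eq h4_relators [(g, False)] [(g, True)]"
  proof -
    \<comment> \<open>The word g g g^-1 reduces to g^-1 by the relator g^2 and to g by
      cancellation.\<close>
    have "pres_eq h4_relators ([] @ [(g, True), (g, True)] @ [(g, False)]) ([] @ [(g, False)])"
      using pres_eq_append[OF _ pres_eq.refl, of _ "[(g, True), (g, True)]" "[]"] weq_square[of g]
      by (simp add: weq_def)
    moreover have "pres_eq h4_relators ([(g, True)] @ [(g, True), (g, \<not> True)] @ []) ([(g, True)] @ [])"
      by (rule pres_eq.cancel)
    ultimately show ?thesis
      by (auto intro: pres_eq.sym pres_eq.trans)
  qed
  then have "pres_eq h4_relators [(g, b)] [(g, True)]"
    by (cases b) (auto intro: pres_eq.refl)
  from pres_eq_append[OF this Cons] show ?case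
    by (simp add: a)
qed (simp add: pres_eq.refl)

lemma carrier_H4: "carrier H4 = range elt"
proof
  show "carrier H4 \<subseteq> range elt"
  proof
    fix x assume "x \<in> carrier H4"
    then obtain u where "x = pres_rel h4_relators `` {u}"
      by (auto simp: H4_def presented_group_def elim: quotientE)
    also have "\<dots> = elt (map fst u)"
      unfolding elt_def using pres_eq_letters
      by (intro equiv_class_eq[OF equiv_pres_rel]) (simp add: pres_rel_def)
    finally show "x \<in> range elt" by simp
  qed
qed (auto simp: elt_carrier)

lemma elt_inv: "inv\<^bsub>H4\<^esub> (elt w) = elt (rev w)"
proof -
  have "group H4"
    by (simp add: H4_def group_presented_group)
  then show ?thesis
    by (rule group.inv_equality) (simp_all add: elt_mult elt_one elt_eq_iff elt_carrier weq_rev_append)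
qed

lemma H4_gens_eq: "H4_gens = range (\<lambda>g. elt [g])"
  by (simp add: H4_gens_def pres_gen_def elt_def)

lemma foldr_mult_elt: "foldr (mult H4) (map (\<lambda>g. elt [g]) w) \<one>\<^bsub>H4\<^esub> = elt w"
  by (induction w) (simp_all add: elt_one elt_mult)

lemma cox_length_elt: "cox_length H4 H4_gens (elt w) = word_length w"
proof -
  have "(\<exists>ss. set ss \<subseteq> H4_gens \<and> length ss = n \<and> foldr (mult H4) ss \<one>\<^bsub>H4\<^esub> = elt w) \<longleftrightarrow>
      (\<exists>v. length v = n \<and> v \<approx> w)" (is "?L \<longleftrightarrow> ?R") for n
  proof
    assume ?L
    then obtain ss where ss: "set ss \<subseteq> range (\<lambda>g. elt [g])" "length ss = n"
      "foldr (mult H4) ss \<one>\<^bsub>H4\<^esub> = elt w"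
      unfolding H4_gens_eq by blast
    then have "\<exists>v. ss = map (\<lambda>g. elt [g]) v"
      unfolding ex_map_conv by blast
    then obtain v where "ss = map (\<lambda>g. elt [g]) v" ..
    then have "length v = n" "v \<approx> w"
      using ss(2,3) by (simp_all add: foldr_mult_elt elt_eq_iff)
    then show ?R by blast
  next
    assume ?R
    then obtain v where "length v = n" "v \<approx> w" by blast
    then show ?L
      by (intro exI[of _ "map (\<lambda>g. elt [g]) v"]) (auto simp: foldr_mult_elt elt_eq_iff H4_gens_eq)
  qed
  then show ?thesis
    by (simp add: cox_length_def word_length_def)
qed

lemma reflections_H4: "reflections H4 H4_gens = (\<lambda>i. elt (root_word i)) ` {..<60}"
proof
  show "reflections H4 H4_gens \<subseteq> (\<lambda>i. elt (root_word i)) ` {..<60}"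
  proof
    fix t assume "t \<in> reflections H4 H4_gens"
    then obtain w g where "t = elt (w @ root_word (simple_root g) @ rev w)"
      by (auto simp: reflections_def carrier_H4 H4_gens_eq elt_mult elt_inv)
    then have "t = elt (root_word (foldr act w (simple_root g)))"
      by (simp only: elt_eq_iff weq_conj_root_word_foldr simple_root_less)
    then show "t \<in> (\<lambda>i. elt (root_word i)) ` {..<60}"
      by auto
  qed
next
  show "(\<lambda>i. elt (root_word i)) ` {..<60} \<subseteq> reflections H4 H4_gens"
  proof
    fix t assume "t \<in> (\<lambda>i. elt (root_word i)) ` {..<60}"
    then obtain x g where "t = elt (x @ [g] @ rev x)"
      using root_word_conj_simple by fastforce
    then have "t = elt x \<otimes>\<^bsub>H4\<^esub> elt [g] \<otimes>\<^bsub>H4\<^esub> inv\<^bsub>H4\<^esub> (elt x)"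
      by (simp add: elt_mult elt_inv)
    then show "t \<in> reflections H4 H4_gens"
      by (auto simp: reflections_def carrier_H4 H4_gens_eq)
  qed
qed

lemma elt_root_word_mem_inversions:
  assumes "i < 60"
  shows "elt (root_word i) \<in> inversions H4 H4_gens (elt w) \<longleftrightarrow> neg w i"
  using assms by (auto simp: inversions_def reflections_H4 elt_mult cox_length_elt word_length_less_iff)


section \<open>The inversion complete set\<close>

text \<open>By minimality each member inverts some reflection that no other member inverts; choosing
  one injects \<open>Y\<close> into the reflections. This bounds the cardinalities under
  \<open>Max\<close> without showing that the group is finite.\<close>

lemma card_minimal_inversion_complete_le:
  assumes "minimal_inversion_complete W S Y" "finite (reflections W S)"
  shows "finite Y" "card Y \<le> card (reflections W S)"
proof -
  have "\<exists>t. t \<in> inversions W S w \<and> (\<forall>v\<in>Y. t \<in> inversions W S v \<longrightarrow> v = w)" if "w \<in> Y" for w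
  proof (rule ccontr)
    assume neg: "\<not> ?thesis"
    have "(\<Union>v\<in>Y - {w}. inversions W S v) = (\<Union>v\<in>Y. inversions W S v)"
      using neg that by blast
    then have "inversion_complete W S (Y - {w})"
      using assms(1) by (auto simp: minimal_inversion_complete_def inversion_complete_def)
    then show False
      using assms(1) that unfolding minimal_inversion_complete_def by blast
  qed
  then obtain t where t: "\<And>w. w \<in> Y \<Longrightarrow>
      t w \<in> inversions W S w \<and> (\<forall>v\<in>Y. t w \<in> inversions W S v \<longrightarrow> v = w)"
    by metis
  have "inj_on t Y"
    by (rule inj_onI) (metis t)
  moreover have "t ` Y \<subseteq> reflections W S"
    using t by (auto simp: inversions_def)
  ultimately show "finite Y" "card Y \<le> card (reflections W S)"
    using assms(2) by (auto intro: inj_on_finite card_inj_on_le)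
qed

text \<open>Dropping a member leaves its private reflection uncovered.\<close>

lemma minimal_inversion_completeI:
  assumes "inversion_complete W S Y"
    and "\<And>w. w \<in> Y \<Longrightarrow> \<exists>t\<in>reflections W S. \<forall>v\<in>Y. t \<in> inversions W S v \<longrightarrow> v = w"
  shows "minimal_inversion_complete W S Y"
  unfolding minimal_inversion_complete_def
proof (intro conjI allI impI notI)
  fix Z assume Z: "Z \<subset> Y" "inversion_complete W S Z"
  then obtain w where w: "w \<in> Y" "w \<notin> Z" by blast
  then obtain t where t: "t \<in> reflections W S" "\<forall>v\<in>Y. t \<in> inversions W S v \<longrightarrow> v = w"
    using assms(2) by blast
  then have "t \<in> (\<Union>v\<in>Z. inversions W S v)"
    using Z(2) by (simp add: inversion_complete_def)
  then show False
    using t(2) w(2) Z(1) by blast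
qed (fact assms(1))

definition witness_words :: "h4_gen list list" where
  "witness_words =
     [[S1, S2, S1, S2, S1, S3, S2, S1, S2, S1, S4, S3, S2, S1, S2, S1, S3, S2, S4],
      [S2, S1, S2, S1, S3, S2, S1, S2, S1, S3, S4, S3, S2, S1, S2, S1, S3, S2, S1, S2,
       S3, S4, S3, S2, S1, S2, S1, S3, S2, S1, S2, S3, S4, S3, S2, S1, S2, S1, S3],
      [S1, S2, S1, S2, S1, S4, S3, S2, S1, S2, S1],
      [S1, S2, S4, S3, S2, S1, S2],
      [S1, S2, S3, S4, S3, S2, S1, S2, S1, S3, S2, S1, S2, S4],
      [S1, S2, S1, S3, S4, S3, S2, S1, S2, S1, S3, S2, S1, S2, S4],
      [S1, S2, S1, S2, S3, S4, S3, S2, S1, S2, S1, S3, S2, S4],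
      [S3, S2, S1, S2, S4, S3, S2, S1, S2, S1, S3, S2, S1, S2, S3, S4, S3, S2, S1, S2,
       S1, S3, S2, S1, S4]]"

text \<open>Entry \<open>k\<close> is a root that, among the eight witness words, only word
  \<open>k\<close> makes negative.\<close>

definition private_roots :: "nat list" where
  "private_roots = [51, 59, 24, 16, 36, 40, 30, 43]"

lemma cover_check: "list_all (\<lambda>i. list_ex (\<lambda>w. neg w i) witness_words) [0..<60]"
  by (simp del: neg.simps add: neg_eq_flips upt_60 witness_words_def act_simps)

lemma private_check: "map (\<lambda>w. map (neg w) private_roots) witness_words =
   map (\<lambda>k. map (\<lambda>l. k = l) [0..<8]) [0..<8]"
  by (simp del: neg.simps add: neg_eq_flips private_roots_def witness_words_def act_simps upt_conv_Cons)

lemma length_witness [simp]: "length witness_words = 8" "length private_roots = 8"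
  by (simp_all add: witness_words_def private_roots_def)

lemma neg_witness_iff:
  "k < 8 \<Longrightarrow> l < 8 \<Longrightarrow> neg (witness_words ! k) (private_roots ! l) \<longleftrightarrow> k = l"
  using arg_cong[OF private_check, of "\<lambda>xs. xs ! k ! l"] by simp

lemma private_roots_less: "l < 8 \<Longrightarrow> private_roots ! l < 60"
  using nth_mem[of l private_roots] by (auto simp: private_roots_def)

theorem mainTheorem8: "MC H4 H4_gens \<ge> 8"
proof -
  let ?v = "\<lambda>k. elt (witness_words ! k)"
  let ?t = "\<lambda>k. elt (root_word (private_roots ! k))"
  let ?Y = "?v ` {..<8}"
  \<comment> \<open>The private reflections both tell the eight group elements apart and show that
    none can be omitted.\<close>
  have private_iff: "?t l \<in> inversions H4 H4_gens (?v k) \<longleftrightarrow> k = l" if "k < 8" "l < 8" for k l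
    using that by (simp add: elt_root_word_mem_inversions private_roots_less neg_witness_iff)
  have "inj_on ?v {..<8}"
  proof (rule inj_onI)
    fix k l :: nat
    assume "k \<in> {..<8}" "l \<in> {..<8}" "?v k = ?v l"
    then show "k = l"
      using private_iff[of k l] private_iff[of l l] by simp
  qed
  then have card: "card ?Y = 8"
    by (simp add: card_image)
  have "inversion_complete H4 H4_gens ?Y"
    unfolding inversion_complete_def
  proof
    show "(\<Union>w\<in>?Y. inversions H4 H4_gens w) = reflections H4 H4_gens"
    proof
      show "reflections H4 H4_gens \<subseteq> (\<Union>w\<in>?Y. inversions H4 H4_gens w)"
      proof
        fix t assume "t \<in> reflections H4 H4_gens"
        then obtain i where i: "i < 60" "t = elt (root_word i)"
          by (auto simp: reflections_H4)
        then obtain w where "w \<in> set witness_words" "neg w i"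
          using cover_check by (force simp: list_all_iff list_ex_iff)
        then obtain k where "k < 8" "neg (witness_words ! k) i"
          by (metis in_set_conv_nth length_witness(1))
        then show "t \<in> (\<Union>w\<in>?Y. inversions H4 H4_gens w)"
          using i elt_root_word_mem_inversions by blast
      qed
    qed (auto simp: inversions_def)
  qed (auto simp: elt_carrier)
  then have "minimal_inversion_complete H4 H4_gens ?Y"
  proof (rule minimal_inversion_completeI)
    fix w assume "w \<in> ?Y"
    then obtain l where l: "l < 8" "w = ?v l" by auto
    then show "\<exists>t\<in>reflections H4 H4_gens. \<forall>v\<in>?Y. t \<in> inversions H4 H4_gens v \<longrightarrow> v = w"
      using private_iff private_roots_less by (intro bexI[of _ "?t l"]) (auto simp: reflections_H4)
  qed
  moreover have "finite {card Y |Y. minimal_inversion_complete H4 H4_gens Y}"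
  proof (rule finite_subset)
    have "finite (reflections H4 H4_gens)"
      by (simp add: reflections_H4)
    then show "{card Y |Y. minimal_inversion_complete H4 H4_gens Y} \<subseteq> {..card (reflections H4 H4_gens)}"
      using card_minimal_inversion_complete_le by fastforce
  qed simp
  ultimately show ?thesis
    unfolding MC_def using card by (intro Max_ge) (auto intro!: exI[of _ ?Y])
qed

end
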